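(* The problem (CP-E-PF) is a relaxation of the problem (NF-E-PF); that is, for every feasible solution $\big((S^g_i)_{i\in N},(W_i)_{i\in N},(S_{ij},S_{ji})_{(i,j)\in E}\big)$ of (NF-E-PF), the tuple $\big((S^g_i)_{i\in N},(W_i)_{i\in N}\big)$ is a feasible solution of (CP-E-PF).
   Context: Conventions. $\mathbf i$ is the imaginary unit, $z^*$ is complex conjugation, $\Re,\Im$ are real and imaginary parts. An inequality between complex numbers, $z\le w$, means $\Re z\le \Re w$ and $\Im z\le\Im w$; a bound $z\in(z^l,z^u)$ on a variable means $z^l\le z\le z^u$ in this sense. Network data. $(N,E)$ is a finite graph with node set $N$; each edge is given one arbitrary orientation, so $E\subseteq N\times N$ has no loops and never contains both $(i,j)$ and $(j,i)$. Each $(i,j)\in E$ carries two flow variables: $S_{ij}$ (power leaving $i$, the "from" side) and $S_{ji}$ (power leaving $j$, the "to" side). Fixed parameters: for $i\in N$, $S^{gl}_i,S^{gu}_i,S^d_i,Y^s_i\in\mathbb C$ and reals $v^l_i,v^u_i\ge 0$; for $(i,j)\in E$, a nonzero line impedance $Z_{ij}\in\mathbb C$ with admittance $Y_{ij}=1/Z_{ij}$, line charging $b^c_{ij}\in\mathbb R$, a nonzero transformer parameter $T_{ij}\in\mathbb C$, an angle difference bound $\theta^\Delta_{ij}\in[0,\pi/2)$; and for each edge side, bounds $S^l_{ij},S^u_{ij},S^l_{ji},S^u_{ji}\in\mathbb C$. (NF-E-PF). Variables: $S^g_i\in(S^{gl}_i,S^{gu}_i)$ complex and $W_i\in((v^l_i)^2,(v^u_i)^2)$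 real for $i\in N$; $S_{ij}\in(S^l_{ij},S^u_{ij})$ and $S_{ji}\in(S^l_{ji},S^u_{ji})$ complex for $(i,j)\in E$. Constraints: (a) for all $i\in N$: $S^g_i-S^d_i-(Y^s_i)^*W_i=\sum_{j:(i,j)\in E}S_{ij}+\sum_{j:(j,i)\in E}S_{ij}$ (sum of the flows leaving $i$ on all incident edges); (b) for all $(i,j)\in E$: $S_{ij}+S_{ji}\ge-\mathbf i\frac{b^c_{ij}}2\left(\frac{W_i}{|T_{ij}|^2}+W_j\right)$; (c) for all $(i,j)\in E$, with $A_{ij}:=Z_{ij}^*T_{ij}^*\left(\left(Y_{ij}^*-\mathbf i\frac{b^c_{ij}}2\right)\frac{W_i}{|T_{ij}|^2}-S_{ij}\right)$: $\tan(-\theta^\Delta_{ij})\Re(A_{ij})\le\Im(A_{ij})$ and $\tan(\theta^\Delta_{ij})\Re(A_{ij})\ge\Im(A_{ij})$. (CP-E-PF). Variables: $S^g_i\in(S^{gl}_i,S^{gu}_i)$ complex and $W_i\in((v^l_i)^2,(v^u_i)^2)$ real for $i\in N$. Single constraint: $$\sum_{i\in N}S^g_i-\sum_{i\in N}S^d_i-\sum_{i\in N}(Y^s_i)^*W_i\ \ge\ \sum_{(i,j)\in E}-\mathbf i\frac{b^c_{ij}}2\left(\frac{W_i}{|T_{ij}|^2}+W_j\right).$$ *)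

theory Defs
  imports Complex_Main
begin

text \<open>Inequalities between complex numbers are componentwise. This is not the order of
  \<^verbatim>\<open>HOL-Library.Complex_Order\<close>, which requires equal imaginary parts.\<close>

definition cle :: "complex \<Rightarrow> complex \<Rightarrow> bool" (infix "\<le>\<^sub>c" 50) where
  "z \<le>\<^sub>c w \<longleftrightarrow> Re z \<le> Re w \<and> Im z \<le> Im w"

text \<open>Node parameters are meaningful on \<^verbatim>\<open>nodes\<close> and line parameters at oriented edges
  \<^verbatim>\<open>(i, j) \<in> edges\<close>. The flow bounds \<^verbatim>\<open>S_lo\<close>, \<^verbatim>\<open>S_up\<close>, like the flow variables below, are
  meaningful at \<^verbatim>\<open>i j\<close> and at \<^verbatim>\<open>j i\<close> for each edge \<^verbatim>\<open>(i, j)\<close>: the value at \<^verbatim>\<open>i j\<close> is the one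
  for the flow leaving \<^verbatim>\<open>i\<close> towards \<^verbatim>\<open>j\<close>. No predicate reads values elsewhere.\<close>

record 'n network =
  nodes :: "'n set"                           (* N *)
  edges :: "('n \<times> 'n) set"                    (* E *)
  Sg_lo :: "'n \<Rightarrow> complex"                    (* S^{gl}_i *)
  Sg_up :: "'n \<Rightarrow> complex"                    (* S^{gu}_i *)
  Sd :: "'n \<Rightarrow> complex"                       (* S^d_i *)
  Ys :: "'n \<Rightarrow> complex"                       (* Y^s_i *)
  v_lo :: "'n \<Rightarrow> real"                        (* v^l_i *)
  v_up :: "'n \<Rightarrow> real"                        (* v^u_i *)
  Z :: "'n \<Rightarrow> 'n \<Rightarrow> complex"                  (* Z_{ij}, line impedance *)
  bc :: "'n \<Rightarrow> 'n \<Rightarrow> real"                    (* b^c_{ij}, line charging *)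
  T :: "'n \<Rightarrow> 'n \<Rightarrow> complex"                  (* T_{ij}, transformer *)
  \<theta>\<Delta> :: "'n \<Rightarrow> 'n \<Rightarrow> real"                    (* angle difference bound *)
  S_lo :: "'n \<Rightarrow> 'n \<Rightarrow> complex"               (* S^l_{ij}, S^l_{ji} *)
  S_up :: "'n \<Rightarrow> 'n \<Rightarrow> complex"               (* S^u_{ij}, S^u_{ji} *)

definition admittance :: "'n network \<Rightarrow> 'n \<Rightarrow> 'n \<Rightarrow> complex" where
  "admittance G i j = 1 / Z G i j"

definition valid_network :: "'n network \<Rightarrow> bool" where
  "valid_network G \<longleftrightarrow>
     finite (nodes G) \<and>
     edges G \<subseteq> nodes G \<times> nodes G \<and>
     (\<forall>i. (i, i) \<notin> edges G) \<and>
     (\<forall>i j. (i, j) \<in> edges G \<longrightarrow> (j, i) \<notin> edges G) \<and>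
     (\<forall>i\<in>nodes G. 0 \<le> v_lo G i \<and> 0 \<le> v_up G i) \<and>
     (\<forall>(i, j)\<in>edges G. Z G i j \<noteq> 0 \<and> T G i j \<noteq> 0 \<and> 0 \<le> \<theta>\<Delta> G i j \<and> \<theta>\<Delta> G i j < pi / 2)"

definition node_bounds :: "'n network \<Rightarrow> ('n \<Rightarrow> complex) \<Rightarrow> ('n \<Rightarrow> real) \<Rightarrow> bool" where
  "node_bounds G Sg W \<longleftrightarrow>
     (\<forall>i\<in>nodes G. Sg_lo G i \<le>\<^sub>c Sg i \<and> Sg i \<le>\<^sub>c Sg_up G i \<and>
                  (v_lo G i)\<^sup>2 \<le> W i \<and> W i \<le> (v_up G i)\<^sup>2)"

definition flow_bounds :: "'n network \<Rightarrow> ('n \<Rightarrow> 'n \<Rightarrow> complex) \<Rightarrow> bool" where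
  "flow_bounds G S \<longleftrightarrow>
     (\<forall>(i, j)\<in>edges G. S_lo G i j \<le>\<^sub>c S i j \<and> S i j \<le>\<^sub>c S_up G i j \<and>
                       S_lo G j i \<le>\<^sub>c S j i \<and> S j i \<le>\<^sub>c S_up G j i)"

text \<open>Right-hand side of the edge constraint, a lower bound on the total flow
  \<^verbatim>\<open>S i j + S j i\<close> (the line loss).\<close>

definition charging :: "'n network \<Rightarrow> ('n \<Rightarrow> real) \<Rightarrow> 'n \<Rightarrow> 'n \<Rightarrow> complex" where
  "charging G W i j =
     - \<i> * (of_real (bc G i j) / 2) * of_real (W i / (cmod (T G i j))\<^sup>2 + W j)"

text \<open>\<^verbatim>\<open>A_{ij}\<close>: solving the AC flow equation for the product \<^verbatim>\<open>V_i * cnj V_j\<close> of the end voltages,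
  with \<^verbatim>\<open>W_i = |V_i|^2\<close>. Its argument is the angle difference bounded by \<^verbatim>\<open>\<theta>\<Delta>\<close>.\<close>

definition angle_product ::
  "'n network \<Rightarrow> ('n \<Rightarrow> real) \<Rightarrow> ('n \<Rightarrow> 'n \<Rightarrow> complex) \<Rightarrow> 'n \<Rightarrow> 'n \<Rightarrow> complex" where
  "angle_product G W S i j =
     cnj (Z G i j) * cnj (T G i j) *
       ((cnj (admittance G i j) - \<i> * (of_real (bc G i j) / 2)) *
          of_real (W i / (cmod (T G i j))\<^sup>2) - S i j)"

definition NF_E_PF_feasible ::
  "'n network \<Rightarrow> ('n \<Rightarrow> complex) \<Rightarrow> ('n \<Rightarrow> real) \<Rightarrow> ('n \<Rightarrow> 'n \<Rightarrow> complex) \<Rightarrow> bool" where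
  "NF_E_PF_feasible G Sg W S \<longleftrightarrow>
     node_bounds G Sg W \<and> flow_bounds G S \<and>
     (\<forall>i\<in>nodes G. Sg i - Sd G i - cnj (Ys G i) * of_real (W i) =
        (\<Sum>j | (i, j) \<in> edges G. S i j) + (\<Sum>j | (j, i) \<in> edges G. S i j)) \<and>
     (\<forall>(i, j)\<in>edges G. charging G W i j \<le>\<^sub>c S i j + S j i) \<and>
     (\<forall>(i, j)\<in>edges G.
        tan (- \<theta>\<Delta> G i j) * Re (angle_product G W S i j) \<le> Im (angle_product G W S i j) \<and>
        tan (\<theta>\<Delta> G i j) * Re (angle_product G W S i j) \<ge> Im (angle_product G W S i j))"

definition CP_E_PF_feasible ::
  "'n network \<Rightarrow> ('n \<Rightarrow> complex) \<Rightarrow> ('n \<Rightarrow> real) \<Rightarrow> bool" where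
  "CP_E_PF_feasible G Sg W \<longleftrightarrow>
     node_bounds G Sg W \<and>
     (\<Sum>(i, j)\<in>edges G. charging G W i j) \<le>\<^sub>c
       (\<Sum>i\<in>nodes G. Sg i) - (\<Sum>i\<in>nodes G. Sd G i) -
       (\<Sum>i\<in>nodes G. cnj (Ys G i) * of_real (W i))"

end

theory Submission
  imports Defs
begin

text \<open>Adding the balance equations of all nodes makes the network collapse to a single node:
  every flow variable occurs in exactly one balance equation, the one of the node that it
  leaves, so the right-hand sides add up to the total loss \<open>S i j + S j i\<close> over all edges
  (\<open>sum_outgoing_flows\<close>). The loss on each edge is bounded below by its line charging term, and
  adding these bounds gives the constraint of the relaxed problem.\<close>

lemma sum_over_successors:
  assumes "finite V" and "R \<subseteq> V \<times> V"
  shows "(\<Sum>i\<in>V. \<Sum>j | (i, j) \<in> R. f i j) = (\<Sum>(i, j)\<in>R. f i j)"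
proof -
  have "finite {j. (i, j) \<in> R}" for i
    using assms by (auto intro: finite_subset [of _ V])
  then have "(\<Sum>i\<in>V. \<Sum>j | (i, j) \<in> R. f i j) = (\<Sum>(i, j)\<in>(SIGMA i:V. {j. (i, j) \<in> R}). f i j)"
    using assms(1) by (intro sum.Sigma) auto
  also have "(SIGMA i:V. {j. (i, j) \<in> R}) = R"
    using assms(2) by auto
  finally show ?thesis .
qed

text \<open>The inner sums range over the edges that start at \<open>i\<close> and over those that end at \<open>i\<close>. The
  latter start at \<open>i\<close> in the converse relation, so that both double sums are handled by the same
  argument and only differ in which of the two flows of an edge they collect.\<close>

lemma sum_outgoing_flows:
  assumes "finite V" and "E \<subseteq> V \<times> V"
  shows "(\<Sum>i\<in>V. (\<Sum>j | (i, j) \<in> E. f i j) + (\<Sum>j | (j, i) \<in> E. f i j)) =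
         (\<Sum>(i, j)\<in>E. f i j + f j i)"
proof -
  have "(\<Sum>i\<in>V. \<Sum>j | (j, i) \<in> E. f i j) = (\<Sum>(i, j)\<in>E\<inverse>. f i j)"
    using sum_over_successors [of V "E\<inverse>" f] assms by auto
  also have "\<dots> = (\<Sum>(i, j)\<in>E. f j i)"
    by (rule sum.reindex_bij_witness [of _ prod.swap prod.swap]) auto
  finally show ?thesis
    by (simp add: sum.distrib sum_over_successors [OF assms] case_prod_unfold)
qed

lemma sum_cle_mono:
  assumes "\<And>x. x \<in> A \<Longrightarrow> f x \<le>\<^sub>c g x"
  shows "sum f A \<le>\<^sub>c sum g A"
  using assms by (auto simp: cle_def intro!: sum_mono)

theorem corollary3p7:
  fixes G :: "'n network"
    and Sg :: "'n \<Rightarrow> complex" and W :: "'n \<Rightarrow> real" and S :: "'n \<Rightarrow> 'n \<Rightarrow> complex"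
  assumes "valid_network G"
    and "NF_E_PF_feasible G Sg W S"
  shows "CP_E_PF_feasible G Sg W"
proof -
  have net: "finite (nodes G)" "edges G \<subseteq> nodes G \<times> nodes G"
    using assms(1) by (auto simp: valid_network_def)
  have bounds: "node_bounds G Sg W"
    and balance: "\<And>i. i \<in> nodes G \<Longrightarrow> Sg i - Sd G i - cnj (Ys G i) * of_real (W i) =
        (\<Sum>j | (i, j) \<in> edges G. S i j) + (\<Sum>j | (j, i) \<in> edges G. S i j)"
    and loss: "\<And>i j. (i, j) \<in> edges G \<Longrightarrow> charging G W i j \<le>\<^sub>c S i j + S j i"
    using assms(2) by (auto simp: NF_E_PF_feasible_def)
  have "(\<Sum>i\<in>nodes G. Sg i) - (\<Sum>i\<in>nodes G. Sd G i) -
          (\<Sum>i\<in>nodes G. cnj (Ys G i) * of_real (W i)) =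
        (\<Sum>i\<in>nodes G. Sg i - Sd G i - cnj (Ys G i) * of_real (W i))"
    by (simp add: sum_subtractf)
  also have "\<dots> = (\<Sum>(i, j)\<in>edges G. S i j + S j i)"
    using balance by (simp add: sum_outgoing_flows [OF net])
  finally have total: "(\<Sum>i\<in>nodes G. Sg i) - (\<Sum>i\<in>nodes G. Sd G i) -
          (\<Sum>i\<in>nodes G. cnj (Ys G i) * of_real (W i)) = (\<Sum>(i, j)\<in>edges G. S i j + S j i)" .
  have "(\<Sum>(i, j)\<in>edges G. charging G W i j) \<le>\<^sub>c (\<Sum>(i, j)\<in>edges G. S i j + S j i)"
    using loss by (auto intro: sum_cle_mono)
  then show ?thesis
    using bounds by (simp add: CP_E_PF_feasible_def total)
qed

end
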